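(* Let $G$ be a well-partitioned chordal graph. If $G$ is a comparability graph, then $\mathcal{R}^p(G)\le 4$.
   Context: All graphs are finite, simple and connected. A comparability graph is a graph admitting a transitive orientation. A graph $G=(V,E)$ is permutationally $k$-representable if there is a word $w=p_1p_2\cdots p_k$, each $p_i$ a permutation of $V$, such that for all distinct $a,b\in V$, $ab\in E$ if and only if $a$ and $b$ alternate in $w$ (the subsequence of $w$ consisting of all occurrences of $a$ and $b$ is of the form $abab\cdots$ or $baba\cdots$). The permutation-representation number $\mathcal{R}^p(G)$ of a comparability graph $G$ is the smallest $k$ such that $G$ is permutationally $k$-representable. A connected graph $G=(V,E)$ is a well-partitioned chordal graph if there exist a partition $\mathcal{P}$ of $V$ and a tree $\mathcal{T}$ with vertex set $\mathcal{P}$ such that: (1) each part is a clique of $G$; (2) for every edge $AB$ of $\mathcal{T}$ there exist $A'\subseteq A$, $B'\subseteq B$ such that the edges of $G$ between $A$ and $B$ are exactly the pairs in $A'\times B'$; (3) for distinct parts $A,B$ not adjacent in $\mathcal{T}$ there are no edges of $G$ between $A$ and $B$. *)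

theory Defs
  imports
    "Graph_Theory.Graph_Theory"
    "HOL-Library.Disjoint_Sets"
    "HOL-Library.Extended_Nat"
    "HOL-Combinatorics.Multiset_Permutations"
begin

text \<open>
  A finite simple undirected graph is a \<^locale>\<open>pair_graph\<close>: a finite vertex set with a symmetric,
  irreflexive edge relation \<^const>\<open>parcs\<close>, so that \<open>ab\<close> is an edge iff \<open>(a, b) \<in> parcs G\<close>.
\<close>

definition connected_graph :: "'a pair_pre_digraph \<Rightarrow> bool" where
  "connected_graph G \<longleftrightarrow> pair_graph G \<and> Digraph_Component.connected (with_proj G)"

text \<open>
  \<^const>\<open>Digraph_Component.tree\<close> is unsuitable here: it forbids all directed cycles, and in a
  symmetric digraph every edge \<open>uv\<close> gives the directed cycle \<open>u, v, u\<close>.  The cycles of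
  the undirected graph are the directed cycles of length at least 3.
\<close>

definition undirected_tree :: "'a pair_pre_digraph \<Rightarrow> bool" where
  "undirected_tree T \<longleftrightarrow>
     connected_graph T \<and> \<not> (\<exists>p. pre_digraph.cycle (with_proj T) p \<and> 3 \<le> length p)"

definition transitive_orientation :: "'a pair_pre_digraph \<Rightarrow> 'a rel \<Rightarrow> bool" where
  "transitive_orientation G D \<longleftrightarrow>
     D \<union> D\<inverse> = parcs G \<and> D \<inter> D\<inverse> = {} \<and> trans D"

definition comparability_graph :: "'a pair_pre_digraph \<Rightarrow> bool" where
  "comparability_graph G \<longleftrightarrow> pair_graph G \<and> (\<exists>D. transitive_orientation G D)"

definition is_clique :: "'a pair_pre_digraph \<Rightarrow> 'a set \<Rightarrow> bool" where
  "is_clique G A \<longleftrightarrow>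
     A \<subseteq> pverts G \<and> (\<forall>a\<in>A. \<forall>b\<in>A. a \<noteq> b \<longrightarrow> (a, b) \<in> parcs G)"

definition edges_between :: "'a pair_pre_digraph \<Rightarrow> 'a set \<Rightarrow> 'a set \<Rightarrow> 'a rel" where
  "edges_between G A B = parcs G \<inter> (A \<times> B)"

definition well_partitioned_chordal :: "'a pair_pre_digraph \<Rightarrow> bool" where
  "well_partitioned_chordal G \<longleftrightarrow>
     connected_graph G \<and>
     (\<exists>P T. partition_on (pverts G) P \<and> undirected_tree T \<and> pverts T = P \<and>
        (\<forall>A\<in>P. is_clique G A) \<and>
        (\<forall>A B. (A, B) \<in> parcs T \<longrightarrow>
           (\<exists>A' B'. A' \<subseteq> A \<and> B' \<subseteq> B \<and> edges_between G A B = A' \<times> B')) \<and>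
        (\<forall>A\<in>P. \<forall>B\<in>P. A \<noteq> B \<and> (A, B) \<notin> parcs T \<longrightarrow> edges_between G A B = {}))"

definition alternating_word :: "'a \<Rightarrow> 'a \<Rightarrow> nat \<Rightarrow> 'a list" where
  "alternating_word a b n = map (\<lambda>i. if even i then a else b) [0..<n]"

definition alternate :: "'a \<Rightarrow> 'a \<Rightarrow> 'a list \<Rightarrow> bool" where
  "alternate a b w \<longleftrightarrow>
     (\<exists>n. filter (\<lambda>x. x = a \<or> x = b) w \<in> {alternating_word a b n, alternating_word b a n})"

definition permutationally_representable :: "nat \<Rightarrow> 'a pair_pre_digraph \<Rightarrow> bool" where
  "permutationally_representable k G \<longleftrightarrow>
     k \<ge> 1 \<and>
     (\<exists>ps. length ps = k \<and> set ps \<subseteq> permutations_of_set (pverts G) \<and>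
        (\<forall>a\<in>pverts G. \<forall>b\<in>pverts G. a \<noteq> b \<longrightarrow>
           ((a, b) \<in> parcs G \<longleftrightarrow> alternate a b (concat ps))))"

text \<open>
  The infimum in \<^typ>\<open>enat\<close> is the least such \<open>k\<close> if there is one, and \<open>\<infinity>\<close> if \<open>G\<close> is not
  permutationally representable; an upper bound by a number thus includes representability.
\<close>

definition permutation_representation_number :: "'a pair_pre_digraph \<Rightarrow> enat" where
  "permutation_representation_number G =
     (INF k\<in>{k. permutationally_representable k G}. enat k)"

end

theory Submission
  imports Defs "HOL-Library.Product_Lexorder"
begin

text \<open>
  Number the parts of the tree so that every part is adjacent to at most one part with a smaller
  number, its parent.  Fix a transitive orientation \<open>D\<close>, read as a strict order; every part is a chain.
  After merging adjacent parts whose union is a clique and making a part squeezed inside a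
  neighbouring part \<open>B\<close> a child of \<open>B\<close>, four linear extensions of \<open>D\<close> reverse all incomparable pairs.

  In the first two, every part \<open>A\<close> is split into its vertices with an upper neighbour outside \<open>A\<close>
  followed by the others, and everything below \<open>A\<close> in the tree is placed in the gap between the two
  pieces; the two extensions list the subtrees in opposite orders, so pairs from unrelated parts
  are reversed.  The third puts each part before its descendants, except for the vertices that lie
  under a vertex \<open>a\<close> of the parent part, which are placed just before the lowest such \<open>a\<close>.  It
  corrects the pairs of a vertex of the upper piece with a vertex in a descendant part.  The
  fourth is the dual of the third and corrects the lower piece.
\<close>

section \<open>Alternation and linear orders\<close>

text \<open>Equality with \<open>[a, b]\<close> records the order and that each letter occurs once,
  so words can be read block by block.\<close>

definition precedes :: "'a list \<Rightarrow> 'a \<Rightarrow> 'a \<Rightarrow> bool" where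
  "precedes p a b \<longleftrightarrow> filter (\<lambda>x. x = a \<or> x = b) p = [a, b]"

lemma precedes_rev: "precedes (rev p) a b \<longleftrightarrow> precedes p b a"
proof -
  have "filter (\<lambda>x. x = a \<or> x = b) p = filter (\<lambda>x. x = b \<or> x = a) p"
    by (rule filter_cong) auto
  then show ?thesis
    unfolding precedes_def rev_filter[symmetric] by (metis rev.simps append.simps rev_rev_ident)
qed

text \<open>Sort by \<open>key\<close>; every linear extension below is given by an injective key
  that increases along \<open>D\<close>.\<close>

lemma linear_order_of_key:
  fixes key :: "'a \<Rightarrow> 'k::linorder"
  assumes "finite V" "inj_on key V"
  obtains p where "p \<in> permutations_of_set V"
    and "\<And>a b. \<lbrakk>a \<in> V; b \<in> V; key a < key b\<rbrakk> \<Longrightarrow> precedes p a b"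
proof -
  obtain xs where xs: "set xs = V" "distinct xs"
    using finite_distinct_list[OF assms(1)] by blast
  define p where "p = sort_key key xs"
  have p: "set p = V" "distinct p" "sorted (map key p)"
    using xs by (simp_all add: p_def)
  have "precedes p a b" if "a \<in> V" "b \<in> V" "key a < key b" for a b
  proof -
    let ?ys = "filter (\<lambda>x. x = a \<or> x = b) p"
    have set: "set ?ys = {a, b}" using p that by auto
    have "length ?ys = card {a, b}"
      using set p(2) by (metis distinct_card distinct_filter)
    also have "\<dots> = 2"
      using that(3) by (cases "a = b") auto
    finally obtain c d where cd: "?ys = [c, d]"
      by (metis (no_types, lifting) One_nat_def Suc_1 length_0_conv length_Suc_conv)
    have "sorted (map key ?ys)"
      using p(3) by (rule sorted_filter)
    with cd set that(3) show ?thesis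
      unfolding precedes_def by (auto simp: doubleton_eq_iff)
  qed
  moreover have "p \<in> permutations_of_set V"
    using p by (intro permutations_of_setI) auto
  ultimately show ?thesis using that by blast
qed

lemma alternating_word_Suc_Suc:
  "alternating_word a b (Suc (Suc n)) = a # b # alternating_word a b n"
proof -
  have "[0..<Suc (Suc n)] = 0 # 1 # map (\<lambda>i. Suc (Suc i)) [0..<n]"
    by (simp add: upt_conv_Cons map_Suc_upt[symmetric] o_def del: upt_Suc)
  then show ?thesis
    by (simp add: alternating_word_def o_def del: upt_Suc)
qed

text \<open>Each block contributes two letters, so the blocks cut the alternating word at even
  positions and each reads \<open>a\<close>, \<open>b\<close>.\<close>

lemma alternating_word_concat_imp_precedes:
  assumes "a \<noteq> b" "\<forall>p\<in>set ps. precedes p a b \<or> precedes p b a"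
    and "filter (\<lambda>x. x = a \<or> x = b) (concat ps) = alternating_word a b n"
  shows "\<forall>p\<in>set ps. precedes p a b"
  using assms(2,3)
proof (induction ps arbitrary: n)
  case (Cons p ps)
  let ?P = "\<lambda>x. x = a \<or> x = b"
  have P: "?P = (\<lambda>x. x = b \<or> x = a)" by auto
  have *: "filter ?P p @ filter ?P (concat ps) = alternating_word a b n"
    using Cons.prems by simp
  have len: "length (filter ?P p) = 2"
    using Cons.prems(1) P unfolding precedes_def by (metis length_Cons list.set_intros(1) list.size(3) Suc_1 One_nat_def)
  have "length (alternating_word a b n) \<ge> 2"
    using * len by (metis length_append le_add1)
  then have "n \<ge> 2" by (simp add: alternating_word_def)
  then obtain m where n: "n = Suc (Suc m)"
    by (metis add_2_eq_Suc le_Suc_ex)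
  have "filter ?P p = [a, b] \<and> filter ?P (concat ps) = alternating_word a b m"
    using * len unfolding n alternating_word_Suc_Suc
    by (cases "filter ?P p" rule: list.exhaust; cases "tl (filter ?P p)") auto
  with Cons show ?case by (auto simp: precedes_def)
qed simp

lemma concat_precedes_alternating_word:
  assumes "\<forall>p\<in>set ps. precedes p a b"
  shows "filter (\<lambda>x. x = a \<or> x = b) (concat ps) = alternating_word a b (2 * length ps)"
  using assms
  by (induction ps) (auto simp: precedes_def alternating_word_Suc_Suc, simp add: alternating_word_def)

text \<open>Two letters alternate in a concatenation of permutations exactly when all permutations
  order them alike. Hence a realizer of the order \<open>D\<close>, that is, linear extensions that
  together reverse all incomparable pairs, represents \<open>G\<close>.\<close>

lemma realizer_imp_permutationally_representable:
  assumes D: "transitive_orientation G D"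
    and ps: "ps \<noteq> []" "set ps \<subseteq> permutations_of_set (pverts G)"
    and ext: "\<And>p a b. p \<in> set ps \<Longrightarrow> (a, b) \<in> D \<Longrightarrow> precedes p a b"
    and sep: "\<And>a b. \<lbrakk>a \<in> pverts G; b \<in> pverts G; a \<noteq> b; (a, b) \<notin> parcs G\<rbrakk>
      \<Longrightarrow> \<exists>p\<in>set ps. precedes p a b"
    and tot: "\<And>p a b. \<lbrakk>p \<in> set ps; a \<in> pverts G; b \<in> pverts G; a \<noteq> b\<rbrakk>
      \<Longrightarrow> precedes p a b \<or> precedes p b a"
  shows "permutationally_representable (length ps) G"
proof -
  have "(a, b) \<in> parcs G \<longleftrightarrow> alternate a b (concat ps)"
    if ab: "a \<in> pverts G" "b \<in> pverts G" "a \<noteq> b" for a b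
  proof
    have sw: "(\<lambda>x. x = b \<or> x = a) = (\<lambda>x. x = a \<or> x = b)" by auto
    {
      assume "(a, b) \<in> parcs G"
      then consider "(a, b) \<in> D" | "(b, a) \<in> D"
        using D by (auto simp: transitive_orientation_def)
      then show "alternate a b (concat ps)"
      proof cases
        case 1
        then show ?thesis
          using concat_precedes_alternating_word[of ps a b] ext unfolding alternate_def by auto
      next
        case 2
        then show ?thesis
          using concat_precedes_alternating_word[of ps b a] ext
          unfolding alternate_def sw by auto
      qed
    }
    {
      assume alt: "alternate a b (concat ps)"
      show "(a, b) \<in> parcs G"
      proof (rule ccontr)
        assume non: "(a, b) \<notin> parcs G"
        then have non': "(b, a) \<notin> parcs G"
          using D by (auto simp: transitive_orientation_def)
        obtain p q where p: "p \<in> set ps" "precedes p a b" and q: "q \<in> set ps" "precedes q b a"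
          using sep ab non non' by metis
        from alt consider n where "filter (\<lambda>x. x = a \<or> x = b) (concat ps) = alternating_word a b n"
          | n where "filter (\<lambda>x. x = b \<or> x = a) (concat ps) = alternating_word b a n"
          unfolding alternate_def sw by auto
        then show False
        proof cases
          case 1
          with alternating_word_concat_imp_precedes[of a b ps n] ab tot q(1)
          have "precedes q a b" by blast
          with q(2) ab show False unfolding precedes_def sw by simp
        next
          case 2
          with alternating_word_concat_imp_precedes[of b a ps n] ab tot p(1)
          have "precedes p b a" by blast
          with p(2) ab show False unfolding precedes_def sw by simp
        qed
      qed
    }
  qed
  moreover have "length ps \<ge> 1" using ps(1) by (cases ps) auto
  ultimately show ?thesis
    unfolding permutationally_representable_def using ps(2) by blast
qed

lemma permutation_precedes_total:
  assumes "p \<in> permutations_of_set V" "a \<in> V" "b \<in> V" "a \<noteq> b"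
  shows "precedes p a b \<or> precedes p b a"
proof -
  let ?ys = "filter (\<lambda>x. x = a \<or> x = b) p"
  have sw: "(\<lambda>x. x = b \<or> x = a) = (\<lambda>x. x = a \<or> x = b)" by auto
  have set: "set ?ys = {a, b}" and "distinct ?ys"
    using assms by (auto dest: permutations_of_setD)
  then have "length ?ys = 2"
    using assms(4) by (metis distinct_card card_2_iff)
  then obtain c d where cd: "?ys = [c, d]"
    by (metis (no_types, lifting) One_nat_def Suc_1 length_0_conv length_Suc_conv)
  with set show ?thesis
    unfolding precedes_def sw by (auto simp: doubleton_eq_iff)
qed

section \<open>Layered orientations\<close>

text \<open>
  The label \<open>\<pi> v\<close> is the number of the part containing \<open>v\<close>.  Label \<open>0\<close> carries no vertices: it is a
  virtual root, the parent of every label without adjacent smaller label.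
\<close>

locale layered =
  fixes V :: "'a set" and E D :: "'a rel" and \<pi> :: "'a \<Rightarrow> nat"
  assumes finite_V: "finite V"
    and E_subset: "E \<subseteq> V \<times> V"
    and orientation: "D \<union> D\<inverse> = E"
    and asym: "D \<inter> D\<inverse> = {}"
    and trans_D: "trans D"
    and label_pos: "v \<in> V \<Longrightarrow> 0 < \<pi> v"
    and same_label: "\<lbrakk>u \<in> V; v \<in> V; u \<noteq> v; \<pi> u = \<pi> v\<rbrakk> \<Longrightarrow> (u, v) \<in> E"
    and parent_unique: "\<lbrakk>(u, v) \<in> E; (u', v') \<in> E; \<pi> v = \<pi> v'; \<pi> u < \<pi> v; \<pi> u' < \<pi> v\<rbrakk>
      \<Longrightarrow> \<pi> u = \<pi> u'"
    and product: "\<lbrakk>(u, v) \<in> E; (u', v') \<in> E; \<pi> u = \<pi> u'; \<pi> v = \<pi> v'; \<pi> u \<noteq> \<pi> v\<rbrakk>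
      \<Longrightarrow> (u, v') \<in> E"
begin

text \<open>The label conditions mention only \<open>E\<close>; this duality turns the third
  extension into the fourth.\<close>

lemma layered_converse: "layered V E (D\<inverse>) \<pi>"
proof (unfold_locales, goal_cases)
  case 3 show ?case using orientation by auto
next
  case 4 show ?case using asym by auto
next
  case 5 show ?case using trans_D by simp
qed (fact finite_V E_subset label_pos same_label | erule (4) parent_unique | erule (4) product)+

lemma sym_E: "(u, v) \<in> E \<Longrightarrow> (v, u) \<in> E"
  using orientation by blast

lemma E_cases: "(u, v) \<in> E \<Longrightarrow> (u, v) \<in> D \<or> (v, u) \<in> D"
  using orientation by blast

lemma D_E: "(u, v) \<in> D \<Longrightarrow> (u, v) \<in> E"
  using orientation by blast

lemma D_trans: "(u, v) \<in> D \<Longrightarrow> (v, w) \<in> D \<Longrightarrow> (u, w) \<in> D"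
  using trans_D by (meson transD)

lemma E_verts: "(u, v) \<in> E \<Longrightarrow> u \<in> V" "(u, v) \<in> E \<Longrightarrow> v \<in> V"
  using E_subset by auto

lemma D_verts: "(u, v) \<in> D \<Longrightarrow> u \<in> V" "(u, v) \<in> D \<Longrightarrow> v \<in> V"
  using E_subset orientation by auto

lemma D_irrefl: "(u, u) \<notin> D"
  using asym by blast

text \<open>The largest of three mutually adjacent labels would have two smaller neighbours. The
  primes let the edges end in different vertices of a part.\<close>

lemma no_label_triangle:
  assumes "(u, v) \<in> E" "(v', w) \<in> E" "(w', u') \<in> E"
    and "\<pi> u' = \<pi> u" "\<pi> v' = \<pi> v" "\<pi> w' = \<pi> w"
    and "\<pi> u \<noteq> \<pi> v" "\<pi> v \<noteq> \<pi> w" "\<pi> u \<noteq> \<pi> w"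
  shows False
proof -
  consider "\<pi> u < \<pi> w" "\<pi> v < \<pi> w" | "\<pi> u < \<pi> v" "\<pi> w < \<pi> v" | "\<pi> v < \<pi> u" "\<pi> w < \<pi> u"
    using assms(7-9) by linarith
  then show False
  proof cases
    case 1
    with parent_unique[OF assms(2) sym_E[OF assms(3)]] assms show False by metis
  next
    case 2
    with parent_unique[OF assms(1) sym_E[OF assms(2)]] assms show False by metis
  next
    case 3
    with parent_unique[OF sym_E[OF assms(1)] assms(3)] assms show False by metis
  qed
qed

section \<open>Parents and ancestors of labels\<close>

definition par :: "nat \<Rightarrow> nat" where
  "par k = (if \<exists>u v. (u, v) \<in> E \<and> \<pi> v = k \<and> \<pi> u < k
    then \<pi> (SOME u. \<exists>v. (u, v) \<in> E \<and> \<pi> v = k \<and> \<pi> u < k) else 0)"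

text \<open>The choice in \<open>par\<close> is immaterial: by \<open>parent_unique\<close> all
  candidates have the same label.\<close>

lemma par_eq:
  assumes "(u, v) \<in> E" "\<pi> u < \<pi> v"
  shows "par (\<pi> v) = \<pi> u"
proof -
  let ?P = "\<lambda>u'. \<exists>v'. (u', v') \<in> E \<and> \<pi> v' = \<pi> v \<and> \<pi> u' < \<pi> v"
  have "?P (SOME u. ?P u)" using assms by (intro someI[of ?P u]) auto
  then have "\<pi> (SOME u. ?P u) = \<pi> u"
    using parent_unique[OF _ assms(1)] assms(2) by auto
  moreover have "\<exists>u' v'. (u', v') \<in> E \<and> \<pi> v' = \<pi> v \<and> \<pi> u' < \<pi> v"
    using assms by blast
  ultimately show ?thesis
    by (simp only: par_def if_True)
qed

lemma par_edge:
  assumes "par k \<noteq> 0"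
  obtains u v where "(u, v) \<in> E" "\<pi> v = k" "\<pi> u = par k" "\<pi> u < k"
proof -
  obtain u v where "(u, v) \<in> E" "\<pi> v = k" "\<pi> u < k"
    using assms unfolding par_def by (auto split: if_splits)
  with par_eq[of u v] that show ?thesis by auto
qed

lemma par_less: "0 < k \<Longrightarrow> par k < k"
  by (cases "par k = 0") (simp, metis par_edge)

definition anc :: "nat rel" where
  "anc = {(par k, k) | k. 0 < k}\<^sup>+"

lemma anc_par: "0 < k \<Longrightarrow> (par k, k) \<in> anc"
  unfolding anc_def by blast

lemma anc_trans: "(i, j) \<in> anc \<Longrightarrow> (j, k) \<in> anc \<Longrightarrow> (i, k) \<in> anc"
  unfolding anc_def by (rule trancl_trans)

lemma anc_less: "(i, k) \<in> anc \<Longrightarrow> i < k"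
  unfolding anc_def by (induction rule: trancl_induct) (auto dest: par_less)

lemma anc_parD: "(i, k) \<in> anc \<Longrightarrow> i = par k \<or> (i, par k) \<in> anc"
  unfolding anc_def by (erule tranclE) auto

lemma anc_childE:
  assumes "(i, k) \<in> anc"
  obtains m where "0 < m" "par m = i" "m = k \<or> (m, k) \<in> anc"
proof -
  obtain m where m: "(i, m) \<in> {(par k, k) | k. 0 < k}" "(m, k) \<in> {(par k, k) | k. 0 < k}\<^sup>*"
    using tranclD[OF assms[unfolded anc_def]] by blast
  have "m = k \<or> (m, k) \<in> anc"
    using m(2) unfolding anc_def rtrancl_eq_or_trancl by blast
  moreover have "0 < m" "par m = i"
    using m(1) by simp_all
  ultimately show thesis by (intro that)
qed

lemma D_label_cases:
  assumes "(u, v) \<in> D"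
  obtains (same) "\<pi> u = \<pi> v"
  | (up) "\<pi> v < \<pi> u" "par (\<pi> u) = \<pi> v"
  | (down) "\<pi> u < \<pi> v" "par (\<pi> v) = \<pi> u"
  using par_eq[OF D_E[OF assms]] par_eq[OF sym_E[OF D_E[OF assms]]] that
  by (metis linorder_neqE_nat)

section \<open>Vertex rankings and the extension that places descendants late\<close>

lemma ex_monotone_ranking:
  obtains r :: "'a \<Rightarrow> nat" where "inj_on r V" "\<And>u v. (u, v) \<in> D \<Longrightarrow> r u < r v"
proof -
  obtain g :: "'a \<Rightarrow> nat" and n where g: "g ` V = {i. i < n}" "inj_on g V"
    using finite_imp_inj_to_nat_seg[OF finite_V] by auto
  \<comment> \<open>Predecessor counts increase strictly along \<open>D\<close>; the enumeration
    \<open>g\<close>, with values below \<open>n\<close>, only breaks ties.\<close>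
  define h where "h v = card {u. (u, v) \<in> D}" for v
  have fin: "finite {u. (u, v) \<in> D}" for v
    by (rule finite_subset[OF _ finite_V]) (auto dest: D_verts)
  have h: "h u < h v" if "(u, v) \<in> D" for u v
    unfolding h_def using that D_irrefl by (intro psubset_card_mono fin) (auto dest: D_trans)
  define r where "r v = h v * n + g v" for v
  have gn: "g v < n" if "v \<in> V" for v using g(1) that by auto
  have "inj_on r V"
  proof (rule inj_onI)
    fix u v assume uv: "u \<in> V" "v \<in> V" "r u = r v"
    have "r u mod n = g u" "r v mod n = g v"
      unfolding r_def using gn uv by auto
    with uv g(2) show "u = v" by (auto dest: inj_onD)
  qed
  moreover have "r u < r v" if "(u, v) \<in> D" for u v
  proof -
    have "r u < (h u + 1) * n" unfolding r_def using gn D_verts(1)[OF that] by simp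
    also have "\<dots> \<le> h v * n" using h[OF that] mult_le_mono1[of "h u + 1" "h v" n] by simp
    also have "\<dots> \<le> r v" unfolding r_def by simp
    finally show ?thesis .
  qed
  ultimately show ?thesis by (rule that)
qed

text \<open>Labels are compared first, so ancestors precede descendants; only vertices lying under
  the parent part move there. The condition on \<open>a\<close> says that it has no upper neighbour
  outside its part, so \<open>a\<close> itself stays in place.\<close>

lemma linear_extension_descendants_above:
  obtains p where "p \<in> permutations_of_set V"
    and "\<And>u v. (u, v) \<in> D \<Longrightarrow> precedes p u v"
    and "\<And>a z. \<lbrakk>a \<in> V; z \<in> V; (a, z) \<notin> E; (\<pi> a, \<pi> z) \<in> anc;
      \<And>y. (a, y) \<in> D \<Longrightarrow> \<pi> y = \<pi> a\<rbrakk> \<Longrightarrow> precedes p a z"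
proof -
  obtain r :: "'a \<Rightarrow> nat" where r: "inj_on r V" "\<And>u v. (u, v) \<in> D \<Longrightarrow> r u < r v"
    using ex_monotone_ranking by blast
  \<comment> \<open>\<open>e v\<close> is the label among whose vertices \<open>v\<close> is placed; \<open>t v\<close> is the rank of the lowest vertex
    with that label above or equal to \<open>v\<close>.\<close>
  define moved where "moved v \<longleftrightarrow> (\<exists>a. (v, a) \<in> D \<and> \<pi> a < \<pi> v)" for v
  define e where "e v = (if moved v then par (\<pi> v) else \<pi> v)" for v
  define T where "T v = {a \<in> V. \<pi> a = e v \<and> (v = a \<or> (v, a) \<in> D)}" for v
  define t where "t v = Min (r ` T v)" for v
  define key where "key v = (e v, t v, r v)" for v
  have fin_T: "finite (T v)" for v
    unfolding T_def using finite_V by auto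
  have T_ne: "T v \<noteq> {}" if "v \<in> V" for v
  proof (cases "moved v")
    case True
    then obtain a where a: "(v, a) \<in> D" "\<pi> a < \<pi> v" unfolding moved_def by blast
    with par_eq[OF sym_E[OF D_E[OF a(1)]]] True D_verts(2)[OF a(1)]
    have "a \<in> T v" by (auto simp: T_def e_def)
    then show ?thesis by blast
  next
    case False
    with that show ?thesis by (auto simp: T_def e_def)
  qed
  have t_le: "t v \<le> r a" if "a \<in> T v" for v a
    unfolding t_def using that fin_T by auto
  have t_ex: "\<exists>a\<in>T v. t v = r a" if "v \<in> V" for v
  proof -
    have "t v \<in> r ` T v"
      unfolding t_def using T_ne[OF that] fin_T[of v] by (intro Min_in) simp_all
    then show ?thesis by auto
  qed
  have r_le: "r v \<le> r a" if "a \<in> T v" for v a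
    using that r(2)[of v a] unfolding T_def by auto
  have t_fixed: "t v = r v" if "v \<in> V" "\<not> moved v" for v
  proof -
    have "v \<in> T v" using that by (auto simp: T_def e_def)
    moreover obtain a where "a \<in> T v" "t v = r a" using t_ex[OF \<open>v \<in> V\<close>] by blast
    ultimately show ?thesis using r_le[of a v] t_le[of v v] by simp
  qed
  have t_moved: "r v < t v" if v: "v \<in> V" "moved v" for v
  proof -
    have "0 < \<pi> v" using label_pos v by simp
    then have "e v \<noteq> \<pi> v" using par_less[of "\<pi> v"] v by (auto simp: e_def)
    moreover obtain a where "a \<in> T v" "t v = r a" using t_ex[OF \<open>v \<in> V\<close>] by blast
    ultimately show ?thesis using r(2)[of v a] by (auto simp: T_def)
  qed
  have e_moved: "e v < \<pi> v" if "v \<in> V" "moved v" for v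
    using that label_pos par_less by (auto simp: e_def)
  have key_mono: "key u < key v" if uv: "(u, v) \<in> D" for u v
  proof -
    have ruv: "r u < r v" by (rule r(2)[OF uv])
    note V = D_verts[OF uv]
    show ?thesis
      using uv
    proof (cases rule: D_label_cases)
      case same
      show ?thesis
      proof (cases "moved v")
        case True
        then have "moved u" using uv same unfolding moved_def by (metis D_trans)
        then have e: "e u = e v" using True same by (simp add: e_def)
        \<comment> \<open>Vertices above \<open>v\<close> are above \<open>u\<close>, so the minimum
          \<open>t u\<close> is at most \<open>t v\<close>; equality is resolved by
          \<open>r\<close>.\<close>
        have "T v \<subseteq> T u" using e uv by (auto simp: T_def dest: D_trans)
        then have "t u \<le> t v" using t_ex[OF V(2)] t_le by fastforce
        with e ruv show ?thesis by (auto simp: key_def)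
      next
        case False
        show ?thesis
        proof (cases "moved u")
          case True
          then have "e u < e v" using e_moved[OF V(1) True] False same by (simp add: e_def)
          then show ?thesis by (simp add: key_def)
        next
          case 2: False
          with False same have "e u = e v" by (simp add: e_def)
          with t_fixed[OF V(1) 2] t_fixed[OF V(2) False] ruv show ?thesis by (simp add: key_def)
        qed
      qed
    next
      case up
      then have mu: "moved u" using uv unfolding moved_def by blast
      \<comment> \<open>Otherwise \<open>u < v < w\<close> passes through three labels, which
        transitivity makes mutually adjacent.\<close>
      have mv: "\<not> moved v"
      proof
        assume "moved v"
        then obtain w where w: "(v, w) \<in> D" "\<pi> w < \<pi> v" unfolding moved_def by blast
        have "(u, w) \<in> D" using uv w(1) by (rule D_trans)
        then show False
          using no_label_triangle[of u v v w w u] uv w up by (auto dest: D_E sym_E)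
      qed
      have e: "e u = e v" using mu mv up by (simp add: e_def)
      have "v \<in> T u" using e uv V mv by (auto simp: T_def e_def)
      then have "t u \<le> r v" by (rule t_le)
      with e t_fixed[OF V(2) mv] ruv show ?thesis by (auto simp: key_def)
    next
      case down
      show ?thesis
      proof (cases "moved v")
        case False
        then have "e v = \<pi> v" by (simp add: e_def)
        moreover have "e u \<le> \<pi> u" using e_moved[OF V(1)] by (cases "moved u") (auto simp: e_def)
        ultimately show ?thesis using down by (simp add: key_def)
      next
        case True
        then have ev: "e v = \<pi> u" using down by (simp add: e_def)
        show ?thesis
        proof (cases "moved u")
          case 2: True
          with ev e_moved[OF V(1) 2] show ?thesis by (simp add: key_def)
        next
          case 2: False
          then have "e u = e v" using ev by (simp add: e_def)
          with t_fixed[OF V(1) 2] t_moved[OF V(2) True] ruv show ?thesis by (simp add: key_def)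
        qed
      qed
    qed
  qed
  have key_desc: "key a < key z"
    if a: "a \<in> V" "z \<in> V" "(a, z) \<notin> E" "(\<pi> a, \<pi> z) \<in> anc"
      and top: "\<And>y. (a, y) \<in> D \<Longrightarrow> \<pi> y = \<pi> a" for a z
  proof -
    have ma: "\<not> moved a" using top unfolding moved_def by fastforce
    then have ea: "e a = \<pi> a" by (simp add: e_def)
    have "\<pi> a \<le> par (\<pi> z)" using anc_parD[OF a(4)] by (auto dest: anc_less)
    then have "\<pi> a \<le> e z" using anc_less[OF a(4)] by (auto simp: e_def)
    then consider "e a < e z" | "e a = e z" using ea by linarith
    then show ?thesis
    proof cases
      case 2
      \<comment> \<open>Here \<open>z\<close> was moved just before \<open>b\<close> in the part of
        \<open>a\<close>. As \<open>a\<close> and \<open>z\<close> are not adjacent,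
        \<open>b\<close> is neither \<open>a\<close> nor below \<open>a\<close>, so
        \<open>a < b\<close> in the chain of that part.\<close>
      obtain b where b: "b \<in> T z" "t z = r b" using t_ex[OF a(2)] by blast
      have "b \<noteq> z" using b 2 ea anc_less[OF a(4)] by (auto simp: T_def)
      then have zb: "(z, b) \<in> D" "b \<in> V" "\<pi> b = \<pi> a" using b 2 ea by (auto simp: T_def)
      have "a \<noteq> b" using a(3) zb sym_E D_E by blast
      then have "(a, b) \<in> D \<or> (b, a) \<in> D" using same_label[OF a(1) zb(2)] zb(3) E_cases by auto
      moreover have "(b, a) \<notin> D" using zb(1) a(3) by (meson D_E D_trans sym_E)
      ultimately have "r a < r b" using r(2) by blast
      with 2 b(2) t_fixed[OF a(1) ma] show ?thesis by (simp add: key_def)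
    qed (simp add: key_def)
  qed
  have "inj_on key V" using r(1) by (auto simp: key_def inj_on_def)
  then obtain p where p: "p \<in> permutations_of_set V"
    "\<And>a b. \<lbrakk>a \<in> V; b \<in> V; key a < key b\<rbrakk> \<Longrightarrow> precedes p a b"
    using linear_order_of_key[OF finite_V] by blast
  show ?thesis
    using that[OF p(1)] p(2) key_mono key_desc D_verts by blast
qed

section \<open>Four linear extensions\<close>

text \<open>
  The subtree of \<open>k\<close> occupies the interval of radius \<open>(1/8) ^ k\<close> around \<open>loc s k\<close>; the children of \<open>k\<close>
  are arranged on one side of \<open>loc s k\<close>, in opposite orders for \<open>s = 1\<close> and \<open>s = -1\<close>.
\<close>

function loc :: "real \<Rightarrow> nat \<Rightarrow> real" where
  "loc s k = (if k = 0 then 0 else loc s (par k) + 2 * s * (1/8) ^ k)"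
  by auto
termination
  by (relation "measure snd") (auto dest: par_less)

declare loc.simps[simp del]

lemma loc_par: "0 < k \<Longrightarrow> loc s k = loc s (par k) + 2 * s * (1/8) ^ k"
  by (subst loc.simps) simp

text \<open>The factor 8 leaves enough room twice: a child \<open>k\<close> reaches at most
  \<open>3 * (1/8) ^ k\<close> from its parent's centre, which stays inside the parent's radius and,
  for a sibling \<open>m < k\<close>, ends before the interval of \<open>m\<close> starts at
  distance \<open>(1/8) ^ m\<close>.\<close>

lemma eighth_power_less:
  assumes "i < k"
  shows "8 * (1/8::real) ^ k \<le> (1/8) ^ i"
proof -
  have "(1/8::real) ^ k \<le> (1/8) ^ Suc i"
    using assms by (intro power_decreasing) auto
  then show ?thesis by simp
qed

text \<open>A child's interval lies strictly inside its parent's; the triangle inequality adds this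
  up along the path.\<close>

lemma loc_anc:
  assumes "\<bar>s\<bar> = 1" "(i, k) \<in> anc"
  shows "\<bar>loc s k - loc s i\<bar> + (1/8) ^ k < (1/8) ^ i"
proof -
  have one_step: "\<bar>loc s k - loc s (par k)\<bar> + (1/8) ^ k < (1/8) ^ par k" if "0 < k" for k
  proof -
    have "\<bar>loc s k - loc s (par k)\<bar> = 2 * (1/8) ^ k"
      using loc_par[OF that, of s] assms(1) by (simp add: abs_mult)
    moreover have "(0::real) < (1/8) ^ k" by simp
    ultimately show ?thesis using eighth_power_less[OF par_less[OF that]] by linarith
  qed
  show ?thesis
    using assms(2) unfolding anc_def
  proof (induction rule: trancl_induct)
    case (base k)
    then show ?case using one_step by auto
  next
    case (step j k)
    then have k: "0 < k" "par k = j" by auto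
    from one_step[OF k(1), unfolded k(2)] step.IH show ?case by linarith
  qed
qed

text \<open>Disjoint intervals in opposite orders for the two signs, so that the first two
  extensions reverse all pairs from the two subtrees.\<close>

definition crossed :: "nat \<Rightarrow> nat \<Rightarrow> bool" where
  "crossed i k \<longleftrightarrow> loc 1 i + (1/8) ^ i < loc 1 k - (1/8) ^ k \<and>
    loc (-1) k + (1/8) ^ k < loc (-1) i - (1/8) ^ i"

lemma crossed_desc:
  assumes "crossed i k" "i' = i \<or> (i, i') \<in> anc" "k' = k \<or> (k, k') \<in> anc"
  shows "crossed i' k'"
proof -
  have *: "\<bar>loc s k' - loc s k\<bar> + (1/8) ^ k' \<le> (1/8) ^ k"
    if "\<bar>s\<bar> = 1" "k' = k \<or> (k, k') \<in> anc" for s k k'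
    using that loc_anc[OF that(1), of k k'] by auto
  have "\<bar>loc 1 k' - loc 1 k\<bar> + (1/8) ^ k' \<le> (1/8) ^ k"
    "\<bar>loc 1 i' - loc 1 i\<bar> + (1/8) ^ i' \<le> (1/8) ^ i"
    "\<bar>loc (-1) k' - loc (-1) k\<bar> + (1/8) ^ k' \<le> (1/8) ^ k"
    "\<bar>loc (-1) i' - loc (-1) i\<bar> + (1/8) ^ i' \<le> (1/8) ^ i"
    using *[of _ k' k] *[of _ i' i] assms(2,3) by simp_all
  then show ?thesis
    using assms(1) unfolding crossed_def by linarith
qed

lemma crossed_siblings:
  assumes "0 < m" "m < k" "par m = par k"
  shows "crossed k m"
proof -
  have "0 < k" using assms by simp
  moreover have "(0::real) < (1/8) ^ k" by simp
  ultimately show ?thesis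
    unfolding crossed_def loc_par[OF assms(1)] loc_par[OF \<open>0 < k\<close>] assms(3)
    using eighth_power_less[OF assms(2)] by (intro conjI; linarith)
qed

text \<open>Unrelated labels lie in the subtrees of two different children of a common ancestor, and
  sibling intervals are crossed.\<close>

lemma crossed_total:
  assumes "i \<noteq> k" "(i, k) \<notin> anc" "(k, i) \<notin> anc"
  shows "crossed i k \<or> crossed k i"
  using assms
proof (induction "i + k" arbitrary: i k rule: less_induct)
  case less
  \<comment> \<open>The larger label \<open>k\<close> climbs to its parent until
    \<open>par k\<close> is an ancestor of \<open>i\<close>; then \<open>i\<close> lies in the
    subtree of a sibling \<open>m\<close> of \<open>k\<close>.\<close>
  have main: "crossed i k \<or> crossed k i"
    if ik: "i < k" "(i, k) \<notin> anc" "(k, i) \<notin> anc"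
      and IH: "\<And>j. \<lbrakk>j < k; i \<noteq> j; (i, j) \<notin> anc; (j, i) \<notin> anc\<rbrakk> \<Longrightarrow> crossed i j \<or> crossed j i" for i k
  proof -
    have k: "0 < k" using ik by simp
    have ne: "i \<noteq> par k" "(i, par k) \<notin> anc"
      using ik(2) anc_par[OF k] anc_trans by blast+
    show ?thesis
    proof (cases "(par k, i) \<in> anc")
      case True
      then obtain m where m: "0 < m" "par m = par k" "m = i \<or> (m, i) \<in> anc"
        by (rule anc_childE)
      have "m \<noteq> k" using m ik by auto
      then have "crossed m k \<or> crossed k m"
        using crossed_siblings m k by (metis linorder_neqE_nat)
      then show ?thesis using crossed_desc m(3) by blast
    next
      case False
      then have "crossed i (par k) \<or> crossed (par k) i"
        using IH[of "par k"] ne par_less[OF k] by blast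
      then show ?thesis using crossed_desc anc_par[OF k] by blast
    qed
  qed
  show ?case
  proof (cases "i < k")
    case True
    have "crossed i j \<or> crossed j i" if "j < k" "i \<noteq> j" "(i, j) \<notin> anc" "(j, i) \<notin> anc" for j
      using less.hyps[of i j] that by simp
    with main[OF True] less.prems show ?thesis by blast
  next
    case False
    then have "k < i" using less.prems by simp
    have "crossed k j \<or> crossed j k" if "j < i" "k \<noteq> j" "(k, j) \<notin> anc" "(j, k) \<notin> anc" for j
      using less.hyps[of k j] that by simp
    with main[OF \<open>k < i\<close>] less.prems show ?thesis by blast
  qed
qed

section \<open>The two extensions that place each subtree in the gap of its top part\<close>

definition low :: "'a \<Rightarrow> bool" where
  "low v \<longleftrightarrow> (\<exists>y. (v, y) \<in> D \<and> \<pi> y \<noteq> \<pi> v)"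

text \<open>The \<open>low\<close> vertices form the lower piece, at the left end of the interval of
  the part; the upper piece is at the right end. Strictly nested descendants fall in
  between.\<close>

definition gap_pos :: "real \<Rightarrow> 'a \<Rightarrow> real" where
  "gap_pos s v = loc s (\<pi> v) + (if low v then -1 else 1) * (1/8) ^ \<pi> v"

lemma gap_pos_anc:
  assumes "\<bar>s\<bar> = 1" "(\<pi> a, \<pi> z) \<in> anc"
  shows "if low a then gap_pos s a < gap_pos s z else gap_pos s z < gap_pos s a"
proof -
  have "(0::real) < (1/8) ^ \<pi> z" by simp
  with loc_anc[OF assms] show ?thesis
    unfolding gap_pos_def by (cases "low a"; cases "low z"; simp only: if_True if_False; linarith)
qed

lemma gap_pos_crossed:
  assumes "crossed (\<pi> u) (\<pi> v)"
  shows "gap_pos 1 u < gap_pos 1 v" "gap_pos (-1) v < gap_pos (-1) u"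
proof -
  have "(0::real) < (1/8) ^ \<pi> u" "(0::real) < (1/8) ^ \<pi> v" by simp_all
  with assms show "gap_pos 1 u < gap_pos 1 v" "gap_pos (-1) v < gap_pos (-1) u"
    unfolding crossed_def gap_pos_def
    by (cases "low u"; cases "low v"; simp only: if_True if_False; linarith)+
qed

text \<open>Within a part \<open>low\<close> passes down the chain, so the split respects
  \<open>D\<close>, and ranks break ties. \<open>not_inside\<close> excludes the one possible
  conflict: a \<open>low\<close> vertex lying above a vertex of a child part.\<close>

lemma linear_extension_gap_pos:
  assumes "\<bar>s\<bar> = 1"
    and not_inside: "\<And>x a y. \<lbrakk>(x, a) \<in> D; (a, y) \<in> D; \<pi> x = \<pi> y\<rbrakk> \<Longrightarrow> \<pi> x \<le> \<pi> a"
  obtains p where "p \<in> permutations_of_set V"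
    and "\<And>u v. (u, v) \<in> D \<Longrightarrow> precedes p u v"
    and "\<And>u v. \<lbrakk>u \<in> V; v \<in> V; gap_pos s u < gap_pos s v\<rbrakk> \<Longrightarrow> precedes p u v"
proof -
  obtain r :: "'a \<Rightarrow> nat" where r: "inj_on r V" "\<And>u v. (u, v) \<in> D \<Longrightarrow> r u < r v"
    using ex_monotone_ranking by blast
  define key where "key v = (gap_pos s v, r v)" for v
  have "inj_on key V" using r(1) by (auto simp: key_def inj_on_def)
  then obtain p where p: "p \<in> permutations_of_set V"
    "\<And>a b. \<lbrakk>a \<in> V; b \<in> V; key a < key b\<rbrakk> \<Longrightarrow> precedes p a b"
    using linear_order_of_key[OF finite_V] by blast
  have "key u < key v" if uv: "(u, v) \<in> D" for u v
    using uv
  proof (cases rule: D_label_cases)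
    case same
    have "low u" if "low v"
      using that uv same unfolding low_def by (metis D_trans)
    then have "gap_pos s u \<le> gap_pos s v" using same by (auto simp: gap_pos_def)
    with r(2)[OF uv] show ?thesis by (auto simp: key_def)
  next
    case up
    \<comment> \<open>Otherwise an upper neighbour \<open>y\<close> of \<open>v\<close> shares the
      label of \<open>u\<close>, as three labels cannot be mutually adjacent, and \<open>v\<close>
      is squeezed inside a child part.\<close>
    have "\<not> low v"
    proof
      assume "low v"
      then obtain y where y: "(v, y) \<in> D" "\<pi> y \<noteq> \<pi> v" unfolding low_def by blast
      have "(u, y) \<in> D" using uv y(1) by (rule D_trans)
      then have "\<pi> u = \<pi> y"
        using no_label_triangle[of u v v y y u] uv y up by (auto dest: D_E sym_E)
      with not_inside[OF uv y(1)] up show False by simp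
    qed
    moreover have "(\<pi> v, \<pi> u) \<in> anc" using up anc_par[of "\<pi> u"] by simp
    ultimately have "gap_pos s u < gap_pos s v" using gap_pos_anc[OF assms(1)] by auto
    then show ?thesis by (simp add: key_def)
  next
    case down
    then have "low u" using uv unfolding low_def by auto
    moreover have "(\<pi> u, \<pi> v) \<in> anc" using down anc_par[of "\<pi> v"] by simp
    ultimately have "gap_pos s u < gap_pos s v" using gap_pos_anc[OF assms(1)] by auto
    then show ?thesis by (simp add: key_def)
  qed
  then have "precedes p u v" if "(u, v) \<in> D" for u v
    using p(2) D_verts[OF that] that by blast
  moreover have "precedes p u v" if "u \<in> V" "v \<in> V" "gap_pos s u < gap_pos s v" for u v
    using p(2) that by (simp add: key_def)
  ultimately show ?thesis using that[OF p(1)] by blast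
qed

text \<open>
  If \<open>a\<close> lies strictly between two vertices of an adjacent part and the two parts do not form a
  clique, then the whole part of \<open>a\<close> lies between these vertices, so it has no other neighbours.
\<close>

lemma sandwiched_class:
  assumes xay: "(x, a) \<in> D" "(a, y) \<in> D" "\<pi> x = \<pi> y" "\<pi> x \<noteq> \<pi> a"
    and nonadj: "a0 \<in> V" "b0 \<in> V" "\<pi> a0 = \<pi> a" "\<pi> b0 = \<pi> x" "(b0, a0) \<notin> E"
    and a': "a' \<in> V" "\<pi> a' = \<pi> a"
  shows "(x, a') \<in> D" "(a', y) \<in> D" "(b0, a') \<notin> E"
proof -
  note V = D_verts[OF xay(1)] D_verts[OF xay(2)]
  \<comment> \<open>Being comparable to \<open>a\<close>, the vertex \<open>c\<close> lies above
    \<open>x\<close> or below \<open>y\<close>; the product condition turns one adjacency into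
    both.\<close>
  have adj: "(x, c) \<in> E" "(y, c) \<in> E" if c: "c \<in> V" "\<pi> c = \<pi> a" for c
  proof -
    have xa: "(x, a) \<in> E" "(y, a) \<in> E" using xay D_E sym_E by blast+
    have "(x, c) \<in> E \<or> (y, c) \<in> E"
    proof (cases "c = a")
      case False
      then have "(c, a) \<in> D \<or> (a, c) \<in> D" using same_label[OF c(1) V(2)] c E_cases by blast
      then show ?thesis using xay D_trans D_E sym_E by blast
    qed (use xa in blast)
    then show "(x, c) \<in> E" "(y, c) \<in> E"
      using product[OF xa(1), of y c] product[OF xa(2), of x c] c xay by auto
  qed
  have non: "(b0, c) \<notin> E" "(c, b0) \<notin> E" if "c \<in> V" "\<pi> c = \<pi> a" for c
  proof -
    show "(b0, c) \<notin> E"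
      using product[of b0 c x a0] adj(1)[of a0] nonadj xay(4) that by auto
    then show "(c, b0) \<notin> E" using sym_E by blast
  qed
  from non(1)[OF a'] show "(b0, a') \<notin> E" .
  have "b0 \<noteq> x" "b0 \<noteq> y" using non(1)[OF V(2)] adj[OF V(2)] by auto
  then have bx: "(b0, x) \<in> D \<or> (x, b0) \<in> D" and yb: "(b0, y) \<in> D \<or> (y, b0) \<in> D"
    using same_label[of b0 x] same_label[of b0 y] nonadj V xay(3) E_cases by auto
  \<comment> \<open>Both positions of \<open>b0\<close> fail: \<open>b0 < x < a\<close> and
    \<open>a' < x < b0\<close> each join \<open>b0\<close> to the part of \<open>a\<close>.\<close>
  have "(a', x) \<notin> D"
  proof
    assume "(a', x) \<in> D"
    then show False using bx non[OF a'] non[OF V(2)] xay(1) D_trans D_E by meson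
  qed
  then show "(x, a') \<in> D" using adj(1)[OF a'] E_cases by blast
  have "(y, a') \<notin> D"
  proof
    assume "(y, a') \<in> D"
    then show False using yb non[OF a'] non[OF V(2)] xay(2) D_trans D_E by meson
  qed
  then show "(a', y) \<in> D" using adj(2)[OF a'] E_cases by blast
qed

text \<open>A neighbour of \<open>a'\<close> in a third part is adjacent to \<open>x\<close> or
  \<open>y\<close> by transitivity, which creates a triangle of labels.\<close>

lemma sandwiched_class_neighbours:
  assumes xay: "(x, a) \<in> D" "(a, y) \<in> D" "\<pi> x = \<pi> y" "\<pi> x \<noteq> \<pi> a"
    and nonadj: "a0 \<in> V" "b0 \<in> V" "\<pi> a0 = \<pi> a" "\<pi> b0 = \<pi> x" "(b0, a0) \<notin> E"
    and c: "(a', c) \<in> E" "\<pi> a' = \<pi> a"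
  shows "\<pi> c = \<pi> a \<or> \<pi> c = \<pi> x"
proof (rule ccontr)
  assume neg: "\<not> ?thesis"
  have a': "(x, a') \<in> D" "(a', y) \<in> D"
    using sandwiched_class[OF xay nonadj E_verts(1)[OF c(1)] c(2)] by auto
  from E_cases[OF c(1)] have "(x, c) \<in> E \<or> (y, c) \<in> E"
    using a' D_trans D_E sym_E by blast
  moreover have "(x, a') \<in> E" "(y, a') \<in> E" using a' D_E sym_E by blast+
  ultimately show False
    using no_label_triangle[of x a' a' c c x] no_label_triangle[of y a' a' c c y] c neg xay sym_E
    by auto
qed

section \<open>Combining the four extensions\<close>

lemma realizer:
  assumes not_inside: "\<And>x a y. \<lbrakk>(x, a) \<in> D; (a, y) \<in> D; \<pi> x = \<pi> y\<rbrakk> \<Longrightarrow> \<pi> x \<le> \<pi> a"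
    and not_clique: "\<And>u v. \<lbrakk>(u, v) \<in> E; \<pi> u \<noteq> \<pi> v\<rbrakk> \<Longrightarrow>
      \<exists>u'\<in>V. \<exists>v'\<in>V. \<pi> u' = \<pi> u \<and> \<pi> v' = \<pi> v \<and> (u', v') \<notin> E"
  obtains ps where "length ps = 4" "set ps \<subseteq> permutations_of_set V"
    and "\<And>p u v. p \<in> set ps \<Longrightarrow> (u, v) \<in> D \<Longrightarrow> precedes p u v"
    and "\<And>u v. \<lbrakk>u \<in> V; v \<in> V; u \<noteq> v; (u, v) \<notin> E\<rbrakk> \<Longrightarrow> \<exists>p\<in>set ps. precedes p u v"
proof -
  interpret dual: layered V E "D\<inverse>" \<pi> by (rule layered_converse)
  obtain p1 where p1: "p1 \<in> permutations_of_set V" "\<And>u v. (u, v) \<in> D \<Longrightarrow> precedes p1 u v"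
    "\<And>u v. \<lbrakk>u \<in> V; v \<in> V; gap_pos 1 u < gap_pos 1 v\<rbrakk> \<Longrightarrow> precedes p1 u v"
    using linear_extension_gap_pos[of 1] not_inside by auto
  obtain p2 where p2: "p2 \<in> permutations_of_set V" "\<And>u v. (u, v) \<in> D \<Longrightarrow> precedes p2 u v"
    "\<And>u v. \<lbrakk>u \<in> V; v \<in> V; gap_pos (-1) u < gap_pos (-1) v\<rbrakk> \<Longrightarrow> precedes p2 u v"
    using linear_extension_gap_pos[of "-1"] not_inside by auto
  obtain p3 where p3: "p3 \<in> permutations_of_set V" "\<And>u v. (u, v) \<in> D \<Longrightarrow> precedes p3 u v"
    "\<And>a z. \<lbrakk>a \<in> V; z \<in> V; (a, z) \<notin> E; (\<pi> a, \<pi> z) \<in> anc;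
      \<And>y. (a, y) \<in> D \<Longrightarrow> \<pi> y = \<pi> a\<rbrakk> \<Longrightarrow> precedes p3 a z"
    using linear_extension_descendants_above by blast
  obtain p4 where p4: "p4 \<in> permutations_of_set V" "\<And>u v. (u, v) \<in> D\<inverse> \<Longrightarrow> precedes p4 u v"
    "\<And>a z. \<lbrakk>a \<in> V; z \<in> V; (a, z) \<notin> E; (\<pi> a, \<pi> z) \<in> anc;
      \<And>y. (a, y) \<in> D\<inverse> \<Longrightarrow> \<pi> y = \<pi> a\<rbrakk> \<Longrightarrow> precedes p4 a z"
    using dual.linear_extension_descendants_above by blast
  \<comment> \<open>\<open>p4\<close> extends the converse of \<open>D\<close>, so its reversal
    extends \<open>D\<close>.\<close>
  let ?ps = "[p1, p2, p3, rev p4]"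
  \<comment> \<open>A \<open>low\<close> vertex whose part has descendants has no lower neighbour
    outside the part: it would be squeezed inside the parent part, and a sandwiched part has no
    other neighbours, whereas a child part is one. So the dual extension \<open>p4\<close> applies
    to it.\<close>
  have low_bottom: "\<pi> l = \<pi> a"
    if a: "low a" "(\<pi> a, k) \<in> anc" "(l, a) \<in> D" for a k l
  proof (rule ccontr)
    assume l: "\<pi> l \<noteq> \<pi> a"
    obtain y where y: "(a, y) \<in> D" "\<pi> y \<noteq> \<pi> a" using a(1) unfolding low_def by blast
    have "(l, y) \<in> D" using a(3) y(1) by (rule D_trans)
    then have ly: "\<pi> l = \<pi> y"
      using no_label_triangle[of l a a y y l] a(3) y l by (auto dest: D_E sym_E)
    have less: "\<pi> l < \<pi> a" using not_inside[OF a(3) y(1) ly] l by simp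
    obtain m where m: "0 < m" "par m = \<pi> a" using a(2) by (rule anc_childE)
    have "0 < \<pi> a" using label_pos D_verts y(1) by blast
    then obtain a' c where c: "(a', c) \<in> E" "\<pi> c = m" "\<pi> a' = \<pi> a" "\<pi> a' < m"
      using par_edge[of m] m by auto
    obtain b0 a0 where "b0 \<in> V" "a0 \<in> V" "\<pi> b0 = \<pi> l" "\<pi> a0 = \<pi> a" "(b0, a0) \<notin> E"
      using not_clique[OF D_E[OF a(3)] l] by blast
    from sandwiched_class_neighbours[OF a(3) y(1) ly l this(2,1,4,3,5) c(1,3)] c less
    show False by simp
  qed
  have "\<exists>p\<in>set ?ps. precedes p u v" if uv: "u \<in> V" "v \<in> V" "u \<noteq> v" "(u, v) \<notin> E" for u v
  proof -
    have vu: "(v, u) \<notin> E" using uv sym_E by blast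
    have "\<pi> u \<noteq> \<pi> v" using same_label uv by blast
    then consider "(\<pi> u, \<pi> v) \<in> anc" | "(\<pi> v, \<pi> u) \<in> anc" | "crossed (\<pi> u) (\<pi> v)" | "crossed (\<pi> v) (\<pi> u)"
      using crossed_total by blast
    then show ?thesis
    proof cases
      case 1
      show ?thesis
      proof (cases "low u")
        case True
        then have "precedes p1 u v" using gap_pos_anc[OF _ 1, of 1] p1(3) uv by auto
        then show ?thesis by simp
      next
        case False
        then have "precedes p3 u v" using p3(3)[OF uv(1,2,4) 1] unfolding low_def by blast
        then show ?thesis by simp
      qed
    next
      case 2
      show ?thesis
      proof (cases "low v")
        case False
        then have "precedes p1 u v" using gap_pos_anc[OF _ 2, of 1] p1(3) uv by auto
        then show ?thesis by simp
      next
        case True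
        then have "precedes p4 v u" using p4(3)[OF uv(2,1) vu 2] low_bottom[OF True 2] by blast
        then show ?thesis by (simp add: precedes_rev)
      qed
    next
      case 3
      then show ?thesis using p1(3) gap_pos_crossed uv by auto
    next
      case 4
      then show ?thesis using p2(3) gap_pos_crossed uv by auto
    qed
  qed
  moreover have "set ?ps \<subseteq> permutations_of_set V"
    using p1(1) p2(1) p3(1) p4(1) by (auto simp: permutations_of_set_def)
  moreover have "precedes p u v" if "p \<in> set ?ps" "(u, v) \<in> D" for p u v
    using that p1(2) p2(2) p3(2) p4(2) by (auto simp: precedes_rev)
  ultimately show ?thesis using that[of ?ps] by simp
qed

section \<open>Normalising the partition\<close>

text \<open>This contracts an edge of the label forest. Keeping the smaller label leaves parents
  below their children.\<close>

lemma merge_labels: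
  assumes e: "(u0, v0) \<in> E" "\<pi> u0 < \<pi> v0"
    and clique: "\<And>u v. \<lbrakk>u \<in> V; v \<in> V; \<pi> u = \<pi> u0; \<pi> v = \<pi> v0\<rbrakk> \<Longrightarrow> (u, v) \<in> E"
  shows "layered V E D (\<lambda>v. if \<pi> v = \<pi> v0 then \<pi> u0 else \<pi> v)" (is "layered V E D ?\<pi>")
proof -
  \<comment> \<open>An edge violating this would give the part of \<open>v0\<close> a second
    adjacent part with a smaller label.\<close>
  have below: "\<pi> u < \<pi> v" "\<pi> v \<noteq> \<pi> v0" if uv: "(u, v) \<in> E" "?\<pi> u < ?\<pi> v" for u v
  proof -
    show ne: "\<pi> v \<noteq> \<pi> v0"
    proof
      assume v: "\<pi> v = \<pi> v0"
      then have "\<pi> u < \<pi> u0" using uv by (auto split: if_splits)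
      with parent_unique[OF uv(1) e(1) v] e(2) v show False by simp
    qed
    show "\<pi> u < \<pi> v"
    proof (rule ccontr)
      assume "\<not> \<pi> u < \<pi> v"
      then have "\<pi> u = \<pi> v0" "\<pi> v < \<pi> u" "\<pi> u0 < \<pi> v"
        using uv ne by (auto split: if_splits)
      with parent_unique[OF sym_E[OF uv(1)] e(1)] e(2) show False by simp
    qed
  qed
  \<comment> \<open>Vertices identified only by the merge come from the parts of \<open>u0\<close>
    and \<open>v0\<close>; a common neighbouring part would close a triangle of labels.\<close>
  have same: "\<pi> u = \<pi> u'"
    if "(u, v) \<in> E" "(u', v') \<in> E" "?\<pi> u = ?\<pi> u'" "?\<pi> v = ?\<pi> v'" "?\<pi> u \<noteq> ?\<pi> v" for u v u' v'
  proof (rule ccontr)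
    assume ne: "\<pi> u \<noteq> \<pi> u'"
    then have "\<pi> u = \<pi> u0 \<and> \<pi> u' = \<pi> v0 \<or> \<pi> u = \<pi> v0 \<and> \<pi> u' = \<pi> u0"
      using that by (auto split: if_splits)
    moreover have "\<pi> v \<noteq> \<pi> u0" "\<pi> v \<noteq> \<pi> v0" "\<pi> v' = \<pi> v"
      using that calculation by (auto split: if_splits)
    ultimately show False
      using no_label_triangle[OF e(1), of u' v' v u] no_label_triangle[OF e(1), of u v v' u']
        that e by (auto dest: sym_E)
  qed
  show ?thesis
  proof (unfold_locales, goal_cases)
    case (6 v)
    then show ?case using label_pos E_verts(1)[OF e(1)] by auto
  next
    case (7 u v)
    then show ?case using clique[of u v] sym_E[OF clique[of v u]] same_label[of u v]
      by (auto split: if_splits)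
  next
    case (8 u v u' v')
    from below[OF 8(1,4)] below[OF 8(2)] 8(3,5) have b: "\<pi> u < \<pi> v" "\<pi> v \<noteq> \<pi> v0" "\<pi> u' < \<pi> v'" "\<pi> v' \<noteq> \<pi> v0"
      by metis+
    then have "\<pi> v = \<pi> v'" using 8(3) by simp
    with parent_unique[OF 8(1,2)] b have "\<pi> u = \<pi> u'" by simp
    then show ?case by simp
  next
    case (9 u v u' v')
    have "\<pi> u = \<pi> u'" using same[OF 9] .
    moreover have "\<pi> v = \<pi> v'"
      using same[OF sym_E[OF 9(1)] sym_E[OF 9(2)] 9(4,3)] 9(5) by metis
    moreover have "\<pi> u \<noteq> \<pi> v" using 9(5) by metis
    ultimately show ?case using product[OF 9(1,2)] by blast
  qed (fact finite_V E_subset orientation asym trans_D)+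
qed

text \<open>The sandwiched part of \<open>a\<close> has no neighbouring part other than that of
  \<open>x\<close>, so a label above all others makes it a child of that part and gives no part a
  second parent.\<close>

lemma raise_label:
  assumes xay: "(x, a) \<in> D" "(a, y) \<in> D" "\<pi> x = \<pi> y" "\<pi> x \<noteq> \<pi> a"
    and nonadj: "a0 \<in> V" "b0 \<in> V" "\<pi> a0 = \<pi> a" "\<pi> b0 = \<pi> x" "(b0, a0) \<notin> E"
    and N: "\<And>v. v \<in> V \<Longrightarrow> \<pi> v < N"
  shows "layered V E D (\<lambda>v. if \<pi> v = \<pi> a then N else \<pi> v)" (is "layered V E D ?\<pi>")
proof -
  have eq: "?\<pi> u = ?\<pi> v \<longleftrightarrow> \<pi> u = \<pi> v" if "u \<in> V" "v \<in> V" for u v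
    using N[OF that(1)] N[OF that(2)] by auto
  show ?thesis
  proof (unfold_locales, goal_cases)
    case (6 v)
    then show ?case using label_pos[of v] N[of v] by auto
  next
    case (7 u v)
    then show ?case using same_label eq by blast
  next
    case (8 u v u' v')
    note V = E_verts[OF 8(1)] E_verts[OF 8(2)]
    have vv: "\<pi> v = \<pi> v'" using eq[OF V(2,4)] 8(3) by blast
    show ?case
    proof (cases "\<pi> v = \<pi> a")
      case True
      have "\<pi> u \<noteq> \<pi> a" "\<pi> u' \<noteq> \<pi> a" using 8(4,5) True by auto
      then have "\<pi> u = \<pi> x" "\<pi> u' = \<pi> x"
        using sandwiched_class_neighbours[OF xay nonadj sym_E[OF 8(1)]]
          sandwiched_class_neighbours[OF xay nonadj sym_E[OF 8(2)]] True vv by auto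
      then show ?thesis by simp
    next
      case False
      then have "\<pi> u < \<pi> v" "\<pi> u' < \<pi> v"
        using 8(4,5) N[OF V(2)] by (auto split: if_splits)
      with parent_unique[OF 8(1,2) vv] show ?thesis by simp
    qed
  next
    case (9 u v u' v')
    note V = E_verts[OF 9(1)] E_verts[OF 9(2)]
    have "\<pi> u = \<pi> u'" "\<pi> v = \<pi> v'" "\<pi> u \<noteq> \<pi> v"
      using 9(3-5) eq V by blast+
    with product[OF 9(1,2)] show ?case by blast
  qed (fact finite_V E_subset orientation asym trans_D)+
qed

end

text \<open>Merge adjacent parts forming a clique while there are any, otherwise raise a part
  squeezed inside one with a larger label. Merging lowers the number of labels; raising does not
  increase it and lowers the number of \<open>inner\<close> vertices.\<close>

lemma ex_normal_layering:
  assumes "layered V E D \<pi>"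
  shows "\<exists>\<pi>. layered V E D \<pi> \<and>
    (\<forall>x a y. (x, a) \<in> D \<longrightarrow> (a, y) \<in> D \<longrightarrow> \<pi> x = \<pi> y \<longrightarrow> \<pi> x \<le> \<pi> a) \<and>
    (\<forall>u v. (u, v) \<in> E \<longrightarrow> \<pi> u \<noteq> \<pi> v \<longrightarrow>
      (\<exists>u'\<in>V. \<exists>v'\<in>V. \<pi> u' = \<pi> u \<and> \<pi> v' = \<pi> v \<and> (u', v') \<notin> E))"
proof -
  define inner where "inner \<pi> = {a \<in> V. \<exists>x y. (x, a) \<in> D \<and> (a, y) \<in> D \<and> \<pi> x = \<pi> y \<and> \<pi> a < \<pi> x}"
    for \<pi> :: "'a \<Rightarrow> nat"
  \<comment> \<open>A lexicographic measure in one number: base \<open>card V + 1\<close> exceeds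
    every possible \<open>card (inner \<pi>)\<close>.\<close>
  define size where "size \<pi> = card (\<pi> ` V) * (card V + 1) + card (inner \<pi>)" for \<pi> :: "'a \<Rightarrow> nat"
  have lex: "c * (n + 1) + i < c' * (n + 1) + j" if "c < c'" "i \<le> n" for c c' i j n :: nat
  proof -
    have "Suc c * (n + 1) \<le> c' * (n + 1)" using that(1) by (intro mult_le_mono1) simp
    with that(2) show ?thesis by simp
  qed
  show ?thesis
    using assms
  proof (induction \<pi> rule: measure_induct_rule[where f = size])
    case (less \<pi>)
    interpret layered V E D \<pi> by fact
    have inner_le: "card (inner \<rho>) \<le> card V" for \<rho>
      unfolding inner_def using finite_V by (intro card_mono) auto
    show ?case
    proof (cases "\<forall>u v. (u, v) \<in> E \<longrightarrow> \<pi> u \<noteq> \<pi> v \<longrightarrow>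
      (\<exists>u'\<in>V. \<exists>v'\<in>V. \<pi> u' = \<pi> u \<and> \<pi> v' = \<pi> v \<and> (u', v') \<notin> E)")
      case False
      then obtain u1 v1 where uv1: "(u1, v1) \<in> E" "\<pi> u1 \<noteq> \<pi> v1"
        "\<And>u v. \<lbrakk>u \<in> V; v \<in> V; \<pi> u = \<pi> u1; \<pi> v = \<pi> v1\<rbrakk> \<Longrightarrow> (u, v) \<in> E" by blast
      obtain u0 v0 where uv: "(u0, v0) \<in> E" "\<pi> u0 < \<pi> v0"
        "\<And>u v. \<lbrakk>u \<in> V; v \<in> V; \<pi> u = \<pi> u0; \<pi> v = \<pi> v0\<rbrakk> \<Longrightarrow> (u, v) \<in> E"
      proof (cases "\<pi> u1 < \<pi> v1")
        case True
        then show ?thesis using uv1 by (intro that[of u1 v1])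
      next
        case False
        then show ?thesis using uv1 by (intro that[of v1 u1]) (auto intro: sym_E)
      qed
      let ?\<pi> = "\<lambda>v. if \<pi> v = \<pi> v0 then \<pi> u0 else \<pi> v"
      have lay: "layered V E D ?\<pi>" by (rule merge_labels[OF uv])
      have "?\<pi> ` V \<subseteq> \<pi> ` V - {\<pi> v0}"
        using uv(2) E_verts[OF uv(1)] by auto
      then have "?\<pi> ` V \<subset> \<pi> ` V" using E_verts(2)[OF uv(1)] by blast
      then have "card (?\<pi> ` V) < card (\<pi> ` V)"
        using finite_V by (intro psubset_card_mono) auto
      then have "size ?\<pi> < size \<pi>"
        unfolding size_def using inner_le by (rule lex)
      then show ?thesis using less.IH lay by blast
    next
      case not_clique: True
      show ?thesis
      proof (cases "inner \<pi> = {}")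
        case True
        then have "\<pi> x \<le> \<pi> a" if "(x, a) \<in> D" "(a, y) \<in> D" "\<pi> x = \<pi> y" for x a y
          using that D_verts(2)[OF that(1)] unfolding inner_def by (auto simp: not_less[symmetric])
        with not_clique layered_axioms show ?thesis by blast
      next
        case False
        then obtain x a y where xay: "(x, a) \<in> D" "(a, y) \<in> D" "\<pi> x = \<pi> y" "\<pi> a < \<pi> x"
          unfolding inner_def by blast
        then have ne: "\<pi> x \<noteq> \<pi> a" by simp
        obtain b0 a0 where nonadj: "a0 \<in> V" "b0 \<in> V" "\<pi> a0 = \<pi> a" "\<pi> b0 = \<pi> x" "(b0, a0) \<notin> E"
          using not_clique D_E[OF xay(1)] ne by metis
        define N where "N = Suc (Max (\<pi> ` V))"
        have N: "\<pi> v < N" if "v \<in> V" for v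
          unfolding N_def using that finite_V by (simp add: less_Suc_eq_le)
        let ?\<pi> = "\<lambda>v. if \<pi> v = \<pi> a then N else \<pi> v"
        have lay: "layered V E D ?\<pi>" by (rule raise_label[OF xay(1-3) ne nonadj N])
        have "card (?\<pi> ` V) \<le> card (\<pi> ` V)"
          unfolding image_image[of "\<lambda>k. if k = \<pi> a then N else k" \<pi> V, symmetric]
          using finite_V by (intro card_image_le) simp
        moreover have "inner ?\<pi> \<subseteq> inner \<pi>"
        proof
          fix c assume "c \<in> inner ?\<pi>"
          then obtain x' y' where c: "(x', c) \<in> D" "(c, y') \<in> D" "?\<pi> x' = ?\<pi> y'" "?\<pi> c < ?\<pi> x'"
            unfolding inner_def by blast
          note V = D_verts[OF c(1)] D_verts[OF c(2)]
          have ca: "\<pi> c \<noteq> \<pi> a" using c(4) N[OF V(1)] by (auto split: if_splits)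
          \<comment> \<open>No new inner vertex arises: if \<open>c\<close> were squeezed inside the
            part of \<open>a\<close>, it would lie in the part of \<open>x\<close>, and
            \<open>b0\<close>, comparable to \<open>c\<close>, would be above \<open>x'\<close> or
            below \<open>y'\<close>, hence adjacent to the part of \<open>a\<close>.\<close>
          have "\<pi> x' \<noteq> \<pi> a"
          proof
            assume x': "\<pi> x' = \<pi> a"
            then have y': "\<pi> y' = \<pi> a" using c(3) N[OF V(4)] by (auto split: if_splits)
            note sw = sandwiched_class[OF xay(1-3) ne nonadj]
            have "\<pi> c = \<pi> x"
              using sandwiched_class_neighbours[OF xay(1-3) ne nonadj D_E[OF c(1)] x'] ca by simp
            moreover have "c \<noteq> b0" using sw(3)[OF V(4) y'] D_E[OF c(2)] by blast
            ultimately consider "(c, b0) \<in> D" | "(b0, c) \<in> D"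
              using same_label[of c b0] nonadj V E_cases by auto
            then show False
            proof cases
              case 1
              then show False using sw(3)[OF V(1) x'] c(1) D_trans D_E sym_E by meson
            next
              case 2
              then show False using sw(3)[OF V(4) y'] c(2) D_trans D_E by meson
            qed
          qed
          with c ca V have "\<pi> x' = \<pi> y'" "\<pi> c < \<pi> x'" using N by (auto split: if_splits)
          with c V show "c \<in> inner \<pi>" unfolding inner_def by blast
        qed
        moreover have "a \<in> inner \<pi>"
          using xay D_verts(2)[OF xay(1)] unfolding inner_def by blast
        moreover have "a \<notin> inner ?\<pi>"
        proof
          assume "a \<in> inner ?\<pi>"
          then obtain z where z: "(z, a) \<in> D" "N < ?\<pi> z" unfolding inner_def by auto
          have "?\<pi> z \<le> N" using N[OF D_verts(1)[OF z(1)]] by simp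
          with z(2) show False by linarith
        qed
        ultimately have "card (inner ?\<pi>) < card (inner \<pi>)"
          using finite_V by (intro psubset_card_mono) (auto simp: inner_def[of \<pi>])
        with \<open>card (?\<pi> ` V) \<le> card (\<pi> ` V)\<close> have "size ?\<pi> < size \<pi>"
          unfolding size_def using mult_le_mono1[of "card (?\<pi> ` V)" "card (\<pi> ` V)" "card V + 1"] by linarith
        then show ?thesis using less.IH lay by blast
      qed
    qed
  qed
qed

section \<open>Numbering the parts of a well-partitioned chordal graph\<close>

text \<open>Grow a connected vertex set one adjacent vertex at a time and number by insertion.
  Acyclicity gives each new vertex only one neighbour in the current set. Numbers start at 1, as 0
  is kept for the virtual root.\<close>

lemma tree_numbering:
  assumes "undirected_tree T"
  obtains g where "inj_on g (pverts T)" "\<And>A. A \<in> pverts T \<Longrightarrow> (0::nat) < g A"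
    "\<And>A A' B. \<lbrakk>(A, B) \<in> parcs T; (A', B) \<in> parcs T; g A < g B; g A' < g B\<rbrakk> \<Longrightarrow> A = A'"
proof -
  interpret pair_graph T
    using assms by (simp add: undirected_tree_def connected_graph_def)
  have "strongly_connected (with_proj T)"
    using assms sym_arcs symmetric_connected_imp_strongly_connected
    unfolding undirected_tree_def connected_graph_def by blast
  then have ne: "pverts T \<noteq> {}"
    and reach: "\<And>u v. u \<in> pverts T \<Longrightarrow> v \<in> pverts T \<Longrightarrow> u \<rightarrow>\<^sup>*\<^bsub>with_proj T\<^esub> v"
    by (auto simp: strongly_connected_def)
  have flip: "(v, u) \<in> parcs T" if "(u, v) \<in> parcs T" for u v
    using sym_arcs that by (auto simp: symmetric_def sym_def)
  define linked where "linked S \<longleftrightarrow> (\<forall>u\<in>S. \<forall>v\<in>S. \<exists>p. apath u p v \<and> set (awalk_verts u p) \<subseteq> S)" for S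
  define inc where "inc S (g :: 'a \<Rightarrow> nat) \<longleftrightarrow> (\<forall>A\<in>S. \<forall>A'\<in>S. \<forall>B\<in>S. (A, B) \<in> parcs T \<longrightarrow>
    (A', B) \<in> parcs T \<longrightarrow> g A < g B \<longrightarrow> g A' < g B \<longrightarrow> A = A')" for S g
  have crossing: "\<exists>A B. A \<in> S \<and> B \<notin> S \<and> (A, B) \<in> parcs T"
    if S: "S \<subseteq> pverts T" "S \<noteq> {}" "S \<noteq> pverts T" for S
  proof -
    obtain u v where uv: "u \<in> S" "v \<in> pverts T" "v \<notin> S" using S by blast
    then have "(u, v) \<in> (parcs T)\<^sup>*"
      using reachable_rtranclI[OF reach[of u v]] S by auto
    then have "v \<notin> S \<longrightarrow> (\<exists>A B. A \<in> S \<and> B \<notin> S \<and> (A, B) \<in> parcs T)"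
    proof (induction rule: rtrancl_induct)
      case base
      then show ?case using uv by blast
    next
      case (step y z)
      then show ?case by blast
    qed
    with uv show ?thesis by blast
  qed
  \<comment> \<open>Two neighbours of \<open>B\<close> in \<open>S\<close> are joined by a nonempty
    path avoiding \<open>B\<close>; with the two arcs at \<open>B\<close> it closes a cycle of
    length at least 3.\<close>
  have single: "A = A'"
    if S: "S \<subseteq> pverts T" "linked S" "A \<in> S" "A' \<in> S" "B \<notin> S" "(A, B) \<in> parcs T" "(A', B) \<in> parcs T"
    for S A A' B
  proof (rule ccontr)
    assume "A \<noteq> A'"
    obtain p where p: "apath A p A'" "set (awalk_verts A p) \<subseteq> S"
      using S unfolding linked_def by blast
    have "p \<noteq> []" using p(1) \<open>A \<noteq> A'\<close> by (auto simp: apath_Nil_iff)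
    have B: "B \<in> pverts T" using S(6) in_arcsD2 by auto
    have w: "awalk A p A'" using p(1) by (simp add: apath_def)
    have w2: "awalk A (p @ [(A', B)]) B"
      using w S(7) B by (auto simp: awalk_simps)
    have "awalk B ((B, A) # p @ [(A', B)]) B"
      using w2 flip[OF S(6)] by (auto simp: awalk_Cons_iff)
    moreover have "distinct (tl (awalk_verts B ((B, A) # p @ [(A', B)])))"
      using awalk_verts_append[OF w2] p S(5) by (auto simp: apath_def)
    ultimately have "cycle ((B, A) # p @ [(A', B)])"
      unfolding cycle_def by blast
    moreover have "3 \<le> length ((B, A) # p @ [(A', B)])"
      using \<open>p \<noteq> []\<close> by (cases p) auto
    ultimately show False using assms unfolding undirected_tree_def by blast
  qed
  have "\<exists>S g. S \<subseteq> pverts T \<and> card S = Suc n \<and> inj_on g S \<and> g ` S \<subseteq> {1..Suc n} \<and> linked S \<and> inc S g"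
    if "Suc n \<le> card (pverts T)" for n
    using that
  proof (induction n)
    case 0
    obtain r where r: "r \<in> pverts T" using ne by blast
    have "linked {r}"
      unfolding linked_def using r by (auto intro!: exI[of _ "[]"] simp: apath_Nil_iff)
    then show ?case
      using r by (intro exI[of _ "{r}"] exI[of _ "\<lambda>_. 1"]) (auto simp: inc_def)
  next
    case (Suc n)
    then obtain S g where S: "S \<subseteq> pverts T" "card S = Suc n" "inj_on g S" "g ` S \<subseteq> {1..Suc n}"
      "linked S" "inc S g" by auto
    have "S \<noteq> pverts T" "S \<noteq> {}" "finite S" using S Suc.prems finite_subset[OF S(1)] by auto
    then obtain A B where AB: "A \<in> S" "B \<notin> S" "(A, B) \<in> parcs T" using crossing S(1) by blast
    have B: "B \<in> pverts T" using AB in_arcsD2 by auto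
    let ?S = "insert B S" and ?g = "g(B := Suc (Suc n))"
    have gS: "?g C = g C" "g C \<le> Suc n" "1 \<le> g C" if "C \<in> S" for C
      using that AB(2) S(4) by auto
    have img: "?g ` S = g ` S" using gS(1) by (rule image_cong[OF refl])
    have "inj_on ?g S" using S(3) inj_on_cong[of S ?g g] gS(1) by blast
    moreover have "?g B \<notin> ?g ` S" unfolding img using S(4) by auto
    moreover have "S - {B} = S" using AB(2) by simp
    ultimately have "inj_on ?g ?S" unfolding inj_on_insert by (simp only: simp_thms)
    moreover have "?g ` ?S \<subseteq> {1..Suc (Suc n)}"
      unfolding image_insert img using S(4) by auto
    moreover have "linked ?S"
      unfolding linked_def
    proof (intro ballI)
      fix u v assume uv: "u \<in> ?S" "v \<in> ?S"
      have toB: "\<exists>p. apath u p B \<and> set (awalk_verts u p) \<subseteq> ?S" if u: "u \<in> S" for u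
      proof -
        obtain p where p: "apath u p A" "set (awalk_verts u p) \<subseteq> S"
          using S(5) AB(1) u unfolding linked_def by blast
        have w: "awalk u (p @ [(A, B)]) B"
          using p(1) AB(3) B by (auto simp: apath_def awalk_simps)
        from awalk_verts_append[OF w] p AB(2) have "apath u (p @ [(A, B)]) B"
          "set (awalk_verts u (p @ [(A, B)])) \<subseteq> ?S"
          using w by (auto simp: apath_def)
        then show ?thesis by blast
      qed
      have fromB: "\<exists>p. apath B p v \<and> set (awalk_verts B p) \<subseteq> ?S" if v: "v \<in> S" for v
      proof -
        obtain p where p: "apath A p v" "set (awalk_verts A p) \<subseteq> S"
          using S(5) AB(1) v unfolding linked_def by blast
        have "apath B ((B, A) # p) v" "set (awalk_verts B ((B, A) # p)) \<subseteq> ?S"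
          using p AB(2) flip[OF AB(3)] by (auto simp: apath_Cons_iff)
        then show ?thesis by blast
      qed
      have "apath B [] B" "set (awalk_verts B []) \<subseteq> ?S" using B by (auto simp: apath_Nil_iff)
      then have BB: "\<exists>p. apath B p B \<and> set (awalk_verts B p) \<subseteq> ?S" by blast
      show "\<exists>p. apath u p v \<and> set (awalk_verts u p) \<subseteq> ?S"
      proof (cases "u = B")
        case True
        then show ?thesis using uv BB fromB by blast
      next
        case False
        then have u: "u \<in> S" using uv by simp
        show ?thesis
        proof (cases "v = B")
          case True
          then show ?thesis using toB[OF u] by blast
        next
          case False
          then have "v \<in> S" using uv by simp
          then show ?thesis using S(5) u unfolding linked_def by blast
        qed
      qed
    qed
    moreover have "inc ?S ?g"
      unfolding inc_def
    proof (intro ballI impI)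
      fix C C' F
      assume h: "C \<in> ?S" "C' \<in> ?S" "F \<in> ?S" "(C, F) \<in> parcs T" "(C', F) \<in> parcs T"
        "?g C < ?g F" "?g C' < ?g F"
      show "C = C'"
      proof (cases "F = B")
        case True
        then have "C \<in> S" "C' \<in> S" using h by auto
        then show ?thesis using single[OF S(1,5)] AB(2) h True by blast
      next
        case False
        then have "F \<in> S" using h by simp
        then have "C \<noteq> B" "C' \<noteq> B" using h(6,7) gS[of F] False by auto
        then have "C \<in> S" "C' \<in> S" using h by auto
        with \<open>F \<in> S\<close> h S(6) gS show ?thesis unfolding inc_def by metis
      qed
    qed
    moreover have "card ?S = Suc (Suc n)" using AB(2) S(2) \<open>finite S\<close> by simp
    ultimately show ?case using S(1) B by (intro exI[of _ ?S] exI[of _ ?g]) blast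
  qed
  moreover have fin: "finite (pverts T)" using finite_verts by simp
  moreover obtain n where n: "card (pverts T) = Suc n"
    using ne fin by (metis card_0_eq not0_implies_Suc)
  ultimately obtain S g where S: "S \<subseteq> pverts T" "card S = Suc n" "inj_on g S"
    "g ` S \<subseteq> {1..Suc n}" "inc S g" by (metis order_refl)
  have eq: "S = pverts T" using S(1,2) n card_subset_eq[OF fin] by simp
  have verts: "A \<in> S" "B \<in> S" if "(A, B) \<in> parcs T" for A B
    using that in_arcsD1 in_arcsD2 unfolding eq by auto
  show ?thesis
  proof (rule that[of g])
    show "inj_on g (pverts T)" using S(3) eq by simp
    show "0 < g A" if "A \<in> pverts T" for A
      using S(4) that eq by force
    show "A = A'" if arcs: "(A, B) \<in> parcs T" "(A', B) \<in> parcs T" "g A < g B" "g A' < g B" for A A' B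
      using S(5) verts[OF arcs(1)] verts(1)[OF arcs(2)] arcs unfolding inc_def by blast
  qed
qed

text \<open>Label each vertex by the number of its part. Cliques give \<open>same_label\<close>, the
  product sets give \<open>product\<close>, and since edges between parts follow the tree, its
  numbering gives \<open>parent_unique\<close>.\<close>

lemma well_partitioned_chordal_layered:
  assumes "well_partitioned_chordal G" "transitive_orientation G D"
  shows "\<exists>\<pi>. layered (pverts G) (parcs G) D \<pi>"
proof -
  obtain P T where P: "partition_on (pverts G) P" and T: "undirected_tree T" "pverts T = P"
    and clique: "\<forall>A\<in>P. is_clique G A"
    and prod: "\<forall>A B. (A, B) \<in> parcs T \<longrightarrow>
      (\<exists>A' B'. A' \<subseteq> A \<and> B' \<subseteq> B \<and> edges_between G A B = A' \<times> B')"
    and none: "\<forall>A\<in>P. \<forall>B\<in>P. A \<noteq> B \<and> (A, B) \<notin> parcs T \<longrightarrow> edges_between G A B = {}"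
    using assms(1) unfolding well_partitioned_chordal_def by (elim conjE exE) (rule that; assumption)
  interpret pair_graph G
    using assms(1) by (simp add: well_partitioned_chordal_def connected_graph_def)
  obtain g :: "'a set \<Rightarrow> nat" where g: "inj_on g P" "\<And>A. A \<in> P \<Longrightarrow> 0 < g A"
    "\<And>A A' B. \<lbrakk>(A, B) \<in> parcs T; (A', B) \<in> parcs T; g A < g B; g A' < g B\<rbrakk> \<Longrightarrow> A = A'"
    using tree_numbering[OF T(1)] T(2) by blast
  have "\<exists>A. A \<in> P \<and> v \<in> A" if "v \<in> pverts G" for v
    using P that by (auto simp: partition_on_def)
  then obtain part where part: "\<And>v. v \<in> pverts G \<Longrightarrow> part v \<in> P \<and> v \<in> part v"
    by metis
  have V: "u \<in> pverts G" "v \<in> pverts G" if "(u, v) \<in> parcs G" for u v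
    using that in_arcsD1 in_arcsD2 by auto
  have g_part: "g (part u) = g (part v) \<longleftrightarrow> part u = part v"
    if "u \<in> pverts G" "v \<in> pverts G" for u v
    using g(1) part that by (auto dest: inj_onD)
  have arc: "(part u, part v) \<in> parcs T" if "(u, v) \<in> parcs G" "part u \<noteq> part v" for u v
  proof -
    have "(u, v) \<in> edges_between G (part u) (part v)"
      using that part V[OF that(1)] by (auto simp: edges_between_def)
    with none part V[OF that(1)] that(2) show ?thesis by blast
  qed
  have "layered (pverts G) (parcs G) D (\<lambda>v. g (part v))"
  proof (unfold_locales, goal_cases)
    case 1 show ?case using finite_verts by simp
  next
    case 2 show ?case using V by auto
  next
    case 3 show ?case using assms(2) by (simp add: transitive_orientation_def)
  next
    case 4 show ?case using assms(2) by (simp add: transitive_orientation_def)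
  next
    case 5 show ?case using assms(2) by (simp add: transitive_orientation_def)
  next
    case (6 v) then show ?case using g(2) part by blast
  next
    case (7 u v)
    then have "part u = part v" using g_part by blast
    then show ?case using clique part[OF 7(1)] part[OF 7(2)] 7(3) unfolding is_clique_def by metis
  next
    case (8 u v u' v')
    note V' = V[OF 8(1)] V[OF 8(2)]
    have "part v = part v'" using g_part V' 8(3) by blast
    moreover have "part u \<noteq> part v" "part u' \<noteq> part v'" using 8 by auto
    ultimately show ?case using g(3)[of "part u" "part v" "part u'"] arc[OF 8(1)] arc[OF 8(2)] 8 by metis
  next
    case (9 u v u' v')
    note V' = V[OF 9(1)] V[OF 9(2)]
    have eq: "part u = part u'" "part v = part v'" "part u \<noteq> part v" using g_part V' 9 by blast+
    obtain A' B' where "edges_between G (part u) (part v) = A' \<times> B'"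
      using prod arc[OF 9(1) eq(3)] by blast
    moreover have "(u, v) \<in> edges_between G (part u) (part v)"
      "(u', v') \<in> edges_between G (part u) (part v)"
      using 9 part V' eq by (auto simp: edges_between_def)
    ultimately have "(u, v') \<in> edges_between G (part u) (part v)" by auto
    then show ?case by (simp add: edges_between_def)
  qed
  then show ?thesis by blast
qed

theorem theorem6:
  fixes G :: "'a pair_pre_digraph"
  assumes "well_partitioned_chordal G"
    and "comparability_graph G"
  shows "permutation_representation_number G \<le> 4"
proof -
  obtain D where D: "transitive_orientation G D"
    using assms(2) unfolding comparability_graph_def by blast
  obtain \<pi>0 where "layered (pverts G) (parcs G) D \<pi>0"
    using well_partitioned_chordal_layered[OF assms(1) D] by blast
  from ex_normal_layering[OF this] obtain \<pi> where \<pi>: "layered (pverts G) (parcs G) D \<pi>"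
    and not_inside: "\<forall>x a y. (x, a) \<in> D \<longrightarrow> (a, y) \<in> D \<longrightarrow> \<pi> x = \<pi> y \<longrightarrow> \<pi> x \<le> \<pi> a"
    and not_clique: "\<forall>u v. (u, v) \<in> parcs G \<longrightarrow> \<pi> u \<noteq> \<pi> v \<longrightarrow>
      (\<exists>u'\<in>pverts G. \<exists>v'\<in>pverts G. \<pi> u' = \<pi> u \<and> \<pi> v' = \<pi> v \<and> (u', v') \<notin> parcs G)"
    by (elim exE conjE) (rule that; assumption)
  interpret layered "pverts G" "parcs G" D \<pi> by (fact \<pi>)
  obtain ps where ps: "length ps = 4" "set ps \<subseteq> permutations_of_set (pverts G)"
    "\<And>p u v. p \<in> set ps \<Longrightarrow> (u, v) \<in> D \<Longrightarrow> precedes p u v"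
    "\<And>u v. \<lbrakk>u \<in> pverts G; v \<in> pverts G; u \<noteq> v; (u, v) \<notin> parcs G\<rbrakk>
      \<Longrightarrow> \<exists>p\<in>set ps. precedes p u v"
    by (rule realizer[OF not_inside[rule_format] not_clique[rule_format]]) (assumption+, rule that)
  have "permutationally_representable (length ps) G"
  proof (rule realizer_imp_permutationally_representable[OF D _ ps(2-4)])
    show "ps \<noteq> []" using ps(1) by auto
    show "precedes p a b \<or> precedes p b a"
      if "p \<in> set ps" "a \<in> pverts G" "b \<in> pverts G" "a \<noteq> b" for p a b
      using permutation_precedes_total[OF subsetD[OF ps(2) that(1)] that(2-4)] .
  qed
  then have "permutation_representation_number G \<le> enat 4"
    unfolding permutation_representation_number_def ps(1) by (intro INF_lower) simp
  then show ?thesis by (simp add: numeral_eq_enat)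
qed

end
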